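(* $\mathrm{fp}(3)=5$. That is, the supremum over all $b>0$ and $(a_1,a_2,a_3,r_1,r_2,r_3)\in\mathbb{R}^6$ of the number of connected components of the solution set $$\{x\in I_3(a,r)\;:\;a_3+(a_2+(a_1+x^{r_1})^{r_2})^{r_3}-b\,x=0\}$$ is equal to $5$.
   Context: $I_3(a,r)\subset\mathbb{R}$ is the (possibly empty) open interval of all real $x$ for which the functions $g_0(x)=x$, $g_1(x)=a_1+x^{r_1}$, $g_2(x)=a_2+g_1(x)^{r_2}$, $g_3(x)=a_3+g_2(x)^{r_3}$ are all defined and strictly positive. The real powers are the usual ones of positive real numbers. *)

theory Defs
  imports "HOL-Analysis.Analysis" "HOL-Library.Extended_Nat"
begin

(* A real power of a positive base is powr. The value of powr at other bases is irrelevant: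
   each base (x, g1, g2) is required to be positive. *)
definition I3 :: "real \<Rightarrow> real \<Rightarrow> real \<Rightarrow> real \<Rightarrow> real \<Rightarrow> real \<Rightarrow> real set" where
  "I3 a1 a2 a3 r1 r2 r3 =
    {x. let g1 = a1 + x powr r1; g2 = a2 + g1 powr r2; g3 = a3 + g2 powr r3
        in 0 < x \<and> 0 < g1 \<and> 0 < g2 \<and> 0 < g3}"

(* card is 0 on infinite sets, so infinitely many components are counted as infinity. *)
definition num_components :: "real set \<Rightarrow> enat" where
  "num_components S = (if finite (components S) then enat (card (components S)) else \<infinity>)"

definition solution_set3 ::
  "real \<Rightarrow> real \<Rightarrow> real \<Rightarrow> real \<Rightarrow> real \<Rightarrow> real \<Rightarrow> real \<Rightarrow> real set" where
  "solution_set3 a1 a2 a3 r1 r2 r3 b =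
    {x \<in> I3 a1 a2 a3 r1 r2 r3. a3 + (a2 + (a1 + x powr r1) powr r2) powr r3 - b * x = 0}"

definition fp3 :: enat where
  "fp3 = Sup {num_components (solution_set3 a1 a2 a3 r1 r2 r3 b) | a1 a2 a3 r1 r2 r3 b. 0 < b}"

end

(* The zeros of the derivative of x |-> g3 x - b x are the zeros of a constant plus
   (r1 - 1) ln x + (r2 - 1) ln g1 + (r3 - 1) ln g2. The derivative of the latter, multiplied by
   x g1 g2, is a combination of the four powers 1, z, z^r2, z^(r2 + 1) of z = g1 x. Such a
   combination has at most 3 positive zeros or vanishes identically, so two applications of
   Rolle's theorem leave at most 5 isolated solutions. An explicit choice of parameters attains 5. *)

theory Submission
  imports Defs
begin

section \<open>Counting zeros with Rolle's theorem\<close>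

text \<open>Finiteness of the zero set is itself part of the claim, so the bound is proved for every
  finite set of zeros of \<open>f\<close>; a uniform bound on these gives both conclusions.\<close>

lemma rolle_card_zeros:
  fixes f f' :: "real \<Rightarrow> real"
  assumes I: "is_interval I"
    and der: "\<And>x. x \<in> I \<Longrightarrow> (f has_real_derivative f' x) (at x)"
    and fin: "finite {x \<in> I. f' x = 0}"
  shows "finite {x \<in> I. f x = 0} \<and> card {x \<in> I. f x = 0} \<le> Suc (card {x \<in> I. f' x = 0})"
proof (rule finite_if_finite_subsets_card_bdd)
  fix S assume S: "S \<subseteq> {x \<in> I. f x = 0}" "finite S"
  \<comment> \<open>Counting only the zeros of \<open>f'\<close> below \<open>Max S\<close>
    strengthens the induction: a new largest zero \<open>b\<close> brings a Rolle point between the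
    old maximum and \<open>b\<close>, which has not been counted yet.\<close>
  have "S \<noteq> {} \<longrightarrow> card S \<le> Suc (card {x \<in> I. f' x = 0 \<and> x < Max S})"
    using S(2,1)
  proof (induction S rule: finite_linorder_max_induct)
    case empty
    then show ?case by simp
  next
    case (insert b S)
    show ?case
    proof (cases "S = {}")
      case False
      let ?m = "Max S"
      have m: "?m \<in> S" "?m < b" using insert False by auto
      have seg: "x \<in> I" if "?m \<le> x" "x \<le> b" for x
        using I m insert.prems that unfolding is_interval_1 by blast
      have "\<exists>z. ?m < z \<and> z < b \<and> DERIV f z :> 0"
      proof (rule Rolle)
        show "f ?m = f b" using insert.prems m by auto
        show "continuous_on {?m..b} f"
          using seg der by (intro continuous_at_imp_continuous_on ballI DERIV_isCont) auto
        show "f differentiable (at x)" if "?m < x" "x < b" for x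
          using seg der[of x] that unfolding real_differentiable_def by auto
      qed (use m in auto)
      then obtain z where z: "?m < z" "z < b" "DERIV f z :> 0" by blast
      then have z': "z \<in> I" "f' z = 0"
        using seg[of z] der[of z] DERIV_unique by (auto dest: DERIV_unique)
      have "insert z {x \<in> I. f' x = 0 \<and> x < ?m} \<subseteq> {x \<in> I. f' x = 0 \<and> x < b}"
        using z z' m by auto
      then have "card (insert z {x \<in> I. f' x = 0 \<and> x < ?m}) \<le> card {x \<in> I. f' x = 0 \<and> x < b}"
        by (rule card_mono[rotated]) (rule finite_subset[OF _ fin], auto)
      moreover have "card (insert z {x \<in> I. f' x = 0 \<and> x < ?m})
          = Suc (card {x \<in> I. f' x = 0 \<and> x < ?m})"
        using z by (subst card_insert_disjoint) (auto intro: finite_subset[OF _ fin])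
      moreover have "Max (insert b S) = b"
        using insert m by (intro Max_eqI) auto
      moreover have "b \<notin> S" using insert.hyps by auto
      ultimately show ?thesis
        using insert False by auto
    qed simp
  qed
  moreover have "card {x \<in> I. f' x = 0 \<and> x < Max S} \<le> card {x \<in> I. f' x = 0}"
    by (rule card_mono[OF fin]) auto
  ultimately show "card S \<le> Suc (card {x \<in> I. f' x = 0})"
    by (cases "S = {}") auto
qed

text \<open>Covers the degenerate case in which the derivative vanishes identically and Rolle's
  count says nothing: \<open>f\<close> is constant on \<open>I\<close>.\<close>

lemma zero_derivative_imp_zeros_all_or_none:
  fixes f :: "real \<Rightarrow> real"
  assumes "is_interval I" and "\<And>x. x \<in> I \<Longrightarrow> (f has_real_derivative 0) (at x)"
  shows "{x \<in> I. f x = 0} = {} \<or> {x \<in> I. f x = 0} = I"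
proof -
  have "\<exists>c. \<forall>x\<in>I. f x = c"
    using assms
    by (intro has_field_derivative_zero_constant)
       (auto simp: is_interval_convex intro: has_field_derivative_at_within)
  then show ?thesis by auto
qed

section \<open>Sums of real powers and their positive zeros\<close>

text \<open>Pairs are (coefficient, exponent). Exponents may repeat and coefficients may be 0, so no
  genericity of the parameters has to be assumed later.\<close>

definition gen_poly :: "(real \<times> real) list \<Rightarrow> real \<Rightarrow> real" where
  "gen_poly ps x = (\<Sum>(c, e)\<leftarrow>ps. c * x powr e)"

lemma gen_poly_simps [simp]:
  "gen_poly [] x = 0"
  "gen_poly ((c, e) # ps) x = c * x powr e + gen_poly ps x"
  by (simp_all add: gen_poly_def)

lemma gen_poly_has_derivative:
  assumes "0 < x"
  shows "(gen_poly ps has_real_derivative gen_poly (map (\<lambda>(c, e). (c * e, e - 1)) ps) x) (at x)"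
proof (induction ps)
  case Nil
  have "gen_poly [] = (\<lambda>x. 0)" by auto
  then show ?case by simp
next
  case (Cons p ps)
  obtain c e where p: "p = (c, e)" by force
  have "gen_poly (p # ps) = (\<lambda>x. c * x powr e + gen_poly ps x)" by (auto simp: p)
  then show ?case
    using assms Cons by (auto simp: p intro!: derivative_eq_intros)
qed

lemma gen_poly_shift:
  "gen_poly (map (\<lambda>(c, e). (c, e - d)) ps) x = gen_poly ps x * x powr (- d)"
  by (induction ps) (auto simp: algebra_simps powr_add[symmetric])

text \<open>Descartes' bound. Dividing by one of the powers and differentiating removes a term.\<close>

lemma gen_poly_zeros:
  "(\<forall>x>0. gen_poly ps x = 0) \<or>
   finite {x. 0 < x \<and> gen_poly ps x = 0} \<and> card {x. 0 < x \<and> gen_poly ps x = 0} < length ps"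
proof (induction "length ps" arbitrary: ps)
  case 0
  then show ?case by simp
next
  case (Suc n)
  then obtain c e qs where ps: "ps = (c, e) # qs" "length qs = n"
    by (metis length_Suc_conv surj_pair)
  define f where "f = gen_poly (map (\<lambda>(c, d). (c, d - e)) ps)"
  \<comment> \<open>After the shift the head of the list has exponent 0, so its derivative vanishes
    and \<open>rs\<close> has only \<open>n\<close> terms.\<close>
  define rs where "rs = map (\<lambda>(c, e). (c * e, e - 1)) (map (\<lambda>(c, d). (c, d - e)) qs)"
  have der: "(f has_real_derivative gen_poly rs x) (at x)" if "x \<in> {0<..}" for x
    unfolding f_def using gen_poly_has_derivative[of x "map (\<lambda>(c, d). (c, d - e)) ps"] that
    by (simp add: ps rs_def)
  have I: "is_interval {0::real<..}" by (auto simp: is_interval_1)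
  have Z: "{x. 0 < x \<and> gen_poly ps x = 0} = {x \<in> {0<..}. f x = 0}"
    by (auto simp: f_def gen_poly_shift)
  consider "\<forall>x>0. gen_poly rs x = 0"
    | "finite {x \<in> {0<..}. gen_poly rs x = 0}" "card {x \<in> {0<..}. gen_poly rs x = 0} < n"
    using Suc.hyps(1)[of rs] ps by (auto simp: rs_def)
  then show ?case
  proof cases
    case 1
    then have "{x \<in> {0<..}. f x = 0} = {} \<or> {x \<in> {0<..}. f x = 0} = {0<..}"
      using der by (intro zero_derivative_imp_zeros_all_or_none I) auto
    then show ?thesis
    proof
      assume none: "{x \<in> {0<..}. f x = 0} = {}"
      show ?thesis unfolding Z none by (simp add: ps)
    next
      assume "{x \<in> {0<..}. f x = 0} = {0<..}"
      then show ?thesis using Z by blast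
    qed
  next
    case 2
    then show ?thesis
      unfolding Z using rolle_card_zeros[OF I der 2(1)] ps by auto
  qed
qed

section \<open>The domain and the fixed-point equation\<close>

definition spow :: "real \<Rightarrow> real \<Rightarrow> real \<Rightarrow> real" where
  "spow a r x = a + x powr r"

text \<open>A real power is monotone on the positive axis, in a direction given by the sign of
  \<open>r\<close>. Unoriented segments treat both directions at once.\<close>

lemma spow_closed_segment:
  assumes "0 < u" "0 < v" "w \<in> closed_segment u v"
  shows "spow a r w \<in> closed_segment (spow a r u) (spow a r v)"
proof -
  have "u powr r \<le> w powr r \<and> w powr r \<le> v powr r \<or> v powr r \<le> w powr r \<and> w powr r \<le> u powr r"
    using assms
    by (cases "0 \<le> r"; cases "u \<le> v") (auto simp: closed_segment_eq_real_ivl powr_mono2 powr_mono2')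
  then show ?thesis by (auto simp: spow_def closed_segment_eq_real_ivl)
qed

lemma closed_segment_pos: "0 < u \<Longrightarrow> 0 < v \<Longrightarrow> w \<in> closed_segment u v \<Longrightarrow> 0 < (w::real)"
  by (auto simp: closed_segment_eq_real_ivl split: if_splits)

lemma mem_I3:
  "x \<in> I3 a1 a2 a3 r1 r2 r3 \<longleftrightarrow> 0 < x \<and> 0 < spow a1 r1 x \<and> 0 < spow a2 r2 (spow a1 r1 x) \<and>
     0 < spow a3 r3 (spow a2 r2 (spow a1 r1 x))"
  by (simp add: I3_def spow_def Let_def)

text \<open>At each stage the value at \<open>w\<close> lies between the values at \<open>u\<close>
  and \<open>v\<close>, so positivity passes from the endpoints to \<open>w\<close>.\<close>

lemma is_interval_I3: "is_interval (I3 a1 a2 a3 r1 r2 r3)"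
  unfolding is_interval_1
proof (intro ballI allI impI)
  fix u v w
  assume uv: "u \<in> I3 a1 a2 a3 r1 r2 r3" "v \<in> I3 a1 a2 a3 r1 r2 r3" and w: "u \<le> w \<and> w \<le> v"
  have s0: "w \<in> closed_segment u v" using w by (auto simp: closed_segment_eq_real_ivl)
  note s1 = spow_closed_segment[OF _ _ s0, of a1 r1]
  note s2 = spow_closed_segment[OF _ _ s1, of a2 r2]
  note s3 = spow_closed_segment[OF _ _ s2, of a3 r3]
  show "w \<in> I3 a1 a2 a3 r1 r2 r3"
    using uv s0 s1 s2 s3 closed_segment_pos unfolding mem_I3 by blast
qed

lemma solution_set3_eq:
  "solution_set3 a1 a2 a3 r1 r2 r3 b =
     {x \<in> I3 a1 a2 a3 r1 r2 r3. spow a3 r3 (spow a2 r2 (spow a1 r1 x)) - b * x = 0}"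
  by (simp add: solution_set3_def spow_def)

section \<open>Derivatives of the displacement and of the logarithmic slope\<close>

lemma spow_has_derivative:
  assumes "(f has_real_derivative f') (at x)" "0 < f x"
  shows "((\<lambda>x. spow a r (f x)) has_real_derivative r * f x powr (r - 1) * f') (at x)"
  unfolding spow_def using assms by (auto intro!: derivative_eq_intros)

text \<open>The chain rule, with \<open>r1 * r2 * r3\<close> kept apart from the powers: they are
  positive on the domain, so this constant alone carries the sign of the slope of g3.\<close>

lemma displacement_has_derivative:
  assumes "x \<in> I3 a1 a2 a3 r1 r2 r3"
  shows "((\<lambda>x. spow a3 r3 (spow a2 r2 (spow a1 r1 x)) - b * x) has_real_derivative
     (r1 * r2 * r3) * (x powr (r1 - 1) * spow a1 r1 x powr (r2 - 1)
        * spow a2 r2 (spow a1 r1 x) powr (r3 - 1)) - b) (at x)"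
proof -
  have "((\<lambda>x. spow a3 r3 (spow a2 r2 (spow a1 r1 x)) - b * x) has_real_derivative
     r3 * spow a2 r2 (spow a1 r1 x) powr (r3 - 1) *
       (r2 * spow a1 r1 x powr (r2 - 1) * (r1 * x powr (r1 - 1) * 1)) - b * 1) (at x)"
    using assms unfolding mem_I3
    by (intro DERIV_diff DERIV_cmult spow_has_derivative DERIV_ident) auto
  then show ?thesis by (rule DERIV_cong) (simp add: mult_ac)
qed

lemma log_slope_has_derivative:
  fixes a1 a2 r1 r2 r3 x :: real
  defines "z \<equiv> spow a1 r1 x"
  assumes pos: "0 < x" "0 < z" "0 < spow a2 r2 z"
  shows "((\<lambda>x. (r1 - 1) * ln x + (r2 - 1) * ln (spow a1 r1 x)
       + (r3 - 1) * ln (spow a2 r2 (spow a1 r1 x)) + k) has_real_derivative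
     gen_poly [(a2 * (r1 * r2 - 1), 1), (- a2 * a1 * r1 * (r2 - 1), 0),
               (r1 * r2 * r3 - 1, 1 + r2), (- a1 * r1 * (r2 * r3 - 1), r2)] z
       / (x * z * spow a2 r2 z)) (at x)"
proof -
  define w where "w = spow a2 r2 z"
  define y where "y = x powr r1"
  define v where "v = z powr r2"
  have x1: "x powr (r1 - 1) = y / x" and z1: "z powr (r2 - 1) = v / z"
    and z2: "z powr (1 + r2) = v * z"
    using pos by (simp_all add: y_def v_def powr_diff powr_add)
  have zy: "z = a1 + y" and wv: "w = a2 + v"
    by (simp_all add: z_def y_def w_def v_def spow_def)
  have p: "0 < w" using pos by (simp add: w_def)
  have d1: "(spow a1 r1 has_real_derivative r1 * (y / x)) (at x)"
    using spow_has_derivative[OF DERIV_ident, of x a1 r1] pos x1 by (simp add: fun_eq_iff)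
  have d2: "((\<lambda>x. spow a2 r2 (spow a1 r1 x)) has_real_derivative r2 * (v / z) * (r1 * (y / x))) (at x)"
    using spow_has_derivative[OF d1, of a2 r2] pos z1 by (simp add: z_def)
  have "((\<lambda>x. (r1 - 1) * ln x + (r2 - 1) * ln (spow a1 r1 x)
       + (r3 - 1) * ln (spow a2 r2 (spow a1 r1 x)) + k) has_real_derivative
     (r1 - 1) / x + (r2 - 1) * (r1 * (y / x) / z)
       + (r3 - 1) * (r2 * (v / z) * (r1 * (y / x)) / w)) (at x)"
    using pos by (auto intro!: derivative_eq_intros d1 d2 simp: z_def w_def field_simps)
  also have "(r1 - 1) / x + (r2 - 1) * (r1 * (y / x) / z)
       + (r3 - 1) * (r2 * (v / z) * (r1 * (y / x)) / w)
     = ((r1 - 1) * z * w + (r2 - 1) * r1 * y * w + (r3 - 1) * r2 * r1 * v * y) / (x * z * w)"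
    using pos p by (simp add: field_simps)
  also have "(r1 - 1) * z * w + (r2 - 1) * r1 * y * w + (r3 - 1) * r2 * r1 * v * y
     = gen_poly [(a2 * (r1 * r2 - 1), 1), (- a2 * a1 * r1 * (r2 - 1), 0),
               (r1 * r2 * r3 - 1, 1 + r2), (- a1 * r1 * (r2 * r3 - 1), r2)] z"
  proof -
    \<comment> \<open>Eliminating \<open>y\<close> makes the numerator a function of
      \<open>z\<close> alone; expanding with \<open>w = a2 + v\<close> leaves the four
      powers.\<close>
    have y: "y = z - a1" using zy by simp
    show ?thesis
      using pos by (simp add: z2 v_def[symmetric] wv y algebra_simps)
  qed
  finally show ?thesis by (simp add: w_def)
qed

section \<open>The upper bound\<close>

text \<open>The connected alternative absorbs the degenerate parameters for which every point of the
  domain is a solution. Otherwise 3 zeros of the numerator give at most 4 critical points and 5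
  solutions.\<close>

lemma solution_set3_connected_or_card_le:
  assumes b: "0 < b"
  shows "connected (solution_set3 a1 a2 a3 r1 r2 r3 b) \<or>
    finite (solution_set3 a1 a2 a3 r1 r2 r3 b) \<and> card (solution_set3 a1 a2 a3 r1 r2 r3 b) \<le> 5"
proof -
  define I where "I = I3 a1 a2 a3 r1 r2 r3"
  define h where "h = (\<lambda>x. spow a3 r3 (spow a2 r2 (spow a1 r1 x)) - b * x)"
  define P where "P = (\<lambda>x. x powr (r1 - 1) * spow a1 r1 x powr (r2 - 1)
        * spow a2 r2 (spow a1 r1 x) powr (r3 - 1))"
  define h' where "h' = (\<lambda>x. (r1 * r2 * r3) * P x - b)"
  have I: "is_interval I" by (simp add: I_def is_interval_I3)
  have S: "solution_set3 a1 a2 a3 r1 r2 r3 b = {x \<in> I. h x = 0}"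
    by (simp add: solution_set3_eq I_def h_def)
  have dh: "(h has_real_derivative h' x) (at x)" if "x \<in> I" for x
    using displacement_has_derivative that unfolding h_def h'_def P_def I_def by blast
  have Ppos: "0 < P x" if "x \<in> I" for x
    using that by (auto simp: P_def I_def mem_I3)
  have few: "finite {x \<in> I. h x = 0} \<and> card {x \<in> I. h x = 0} \<le> Suc n"
    if "finite {x \<in> I. h' x = 0}" "card {x \<in> I. h' x = 0} \<le> n" for n
    using rolle_card_zeros[OF I dh that(1)] that(2) by auto
  have none: ?thesis if "{x \<in> I. h' x = 0} = {}"
    using few[of 0] that unfolding S by auto
  show ?thesis
  proof (cases "0 < r1 * r2 * r3")
    \<comment> \<open>The slope of g3 is then nonpositive while \<open>b\<close> is positive, so
      there is no critical point and at most one solution.\<close>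
    case False
    have "h' x < 0" if "x \<in> I" for x
      using Ppos[OF that] False b mult_nonpos_nonneg[of "r1 * r2 * r3" "P x"] by (auto simp: h'_def)
    then show ?thesis using none by force
  next
    case True
    define l where "l = (\<lambda>x. (r1 - 1) * ln x + (r2 - 1) * ln (spow a1 r1 x)
       + (r3 - 1) * ln (spow a2 r2 (spow a1 r1 x)) + (ln (r1 * r2 * r3) - ln b))"
    define \<phi> where "\<phi> = gen_poly [(a2 * (r1 * r2 - 1), 1), (- a2 * a1 * r1 * (r2 - 1), 0),
               (r1 * r2 * r3 - 1, 1 + r2), (- a1 * r1 * (r2 * r3 - 1), r2)]"
    define l' where "l' = (\<lambda>x. \<phi> (spow a1 r1 x) / (x * spow a1 r1 x * spow a2 r2 (spow a1 r1 x)))"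
    have dl: "(l has_real_derivative l' x) (at x)" if "x \<in> I" for x
      unfolding l_def l'_def \<phi>_def using that
      by (intro log_slope_has_derivative) (auto simp: I_def mem_I3)
    \<comment> \<open>Both the slope of g3 and \<open>b\<close> are positive, so they agree exactly
      when their logarithms do.\<close>
    have h'l: "h' x = 0 \<longleftrightarrow> l x = 0" if "x \<in> I" for x
    proof -
      have "ln (r1 * r2 * r3 * P x) = l x + ln b"
        using that True unfolding P_def l_def I_def mem_I3
        by (subst ln_mult_pos) (auto simp: ln_mult_pos ln_powr)
      moreover have "h' x = 0 \<longleftrightarrow> ln (r1 * r2 * r3 * P x) = ln b"
        using True b Ppos[OF that] by (subst ln_inj_iff) (auto simp: h'_def)
      ultimately show ?thesis by auto
    qed
    then have Zl: "{x \<in> I. h' x = 0} = {x \<in> I. l x = 0}" by auto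
    consider "\<forall>z>0. \<phi> z = 0" | "finite {z. 0 < z \<and> \<phi> z = 0}" "card {z. 0 < z \<and> \<phi> z = 0} < 4"
      using gen_poly_zeros[of "[(a2 * (r1 * r2 - 1), 1), (- a2 * a1 * r1 * (r2 - 1), 0),
               (r1 * r2 * r3 - 1, 1 + r2), (- a1 * r1 * (r2 * r3 - 1), r2)]"]
      by (fold \<phi>_def) auto
    then show ?thesis
    proof cases
      \<comment> \<open>Here \<open>l\<close> is constant on \<open>I\<close>, so \<open>h'\<close>
        vanishes nowhere or everywhere on \<open>I\<close>. In the latter case \<open>h\<close> is
        constant too, and the solution set is empty or all of \<open>I\<close>.\<close>
      case 1
      have "l' x = 0" if "x \<in> I" for x
        using 1 that by (auto simp: l'_def I_def mem_I3)
      then have "{x \<in> I. h' x = 0} = {} \<or> {x \<in> I. h' x = 0} = I"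
        unfolding Zl using dl by (intro zero_derivative_imp_zeros_all_or_none I) metis
      moreover have ?thesis if "{x \<in> I. h' x = 0} = I"
      proof -
        have "{x \<in> I. h x = 0} = {} \<or> {x \<in> I. h x = 0} = I"
          using dh that by (intro zero_derivative_imp_zeros_all_or_none I) force
        then have "connected {x \<in> I. h x = 0}"
          using is_interval_connected[OF I] by (elim disjE) (simp_all only: connected_empty)
        then show ?thesis unfolding S by simp
      qed
      ultimately show ?thesis using none by blast
    next
      case 2
      \<comment> \<open>With \<open>r1\<close> nonzero the substitution
        \<open>z = spow a1 r1 x\<close> is injective, so the bound on zeros in \<open>z\<close> is
        also a bound on zeros in \<open>x\<close>.\<close>
      have "r1 \<noteq> 0" using True by auto
      then have inj: "inj_on (spow a1 r1) {x \<in> I. l' x = 0}"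
        by (intro inj_on_inverseI[of _ "\<lambda>z. (z - a1) powr (1 / r1)"])
           (auto simp: spow_def I_def mem_I3 powr_powr)
      have sub: "spow a1 r1 ` {x \<in> I. l' x = 0} \<subseteq> {z. 0 < z \<and> \<phi> z = 0}"
        by (auto simp: I_def mem_I3 l'_def)
      have "finite {x \<in> I. l' x = 0}"
        using inj_on_finite[OF inj sub 2(1)] .
      moreover have "card {x \<in> I. l' x = 0} \<le> 3"
        using card_inj_on_le[OF inj sub 2(1)] 2(2) by simp
      ultimately have "finite {x \<in> I. h' x = 0}" "card {x \<in> I. h' x = 0} \<le> 4"
        unfolding Zl using rolle_card_zeros[OF I dl] by auto
      from few[OF this] show ?thesis unfolding S by simp
    qed
  qed
qed

section \<open>From solutions to connected components\<close>

text \<open>A nonempty finite connected set of reals is a singleton, so the components are the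
  single points.\<close>

lemma num_components_finite:
  assumes "finite S"
  shows "num_components S = enat (card S)"
proof -
  have "components S = (\<lambda>x. {x}) ` S"
  proof (intro equalityI subsetI)
    fix C assume C: "C \<in> components S"
    then have "connected C" "C \<noteq> {}" "C \<subseteq> S"
      by (auto simp: in_components_connected in_components_nonempty in_components_subset)
    then show "C \<in> (\<lambda>x. {x}) ` S"
      using assms connected_finite_iff_sing[of C] finite_subset by auto
  next
    fix C assume "C \<in> (\<lambda>x. {x}) ` S"
    then obtain x where x: "x \<in> S" "C = {x}" by auto
    let ?D = "connected_component_set S x"
    have "x \<in> ?D" "finite ?D"
      using x assms by (auto simp: connected_component_refl intro: finite_subset[OF connected_component_subset])
    then have "?D = {x}"
      by (metis connected_finite_iff_sing connected_connected_component empty_iff singletonD)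
    then show "C \<in> components S" using x by (auto simp: components_def)
  qed
  moreover have "card ((\<lambda>x. {x}) ` S) = card S" by (rule card_image) auto
  ultimately show ?thesis using assms by (simp add: num_components_def)
qed

lemma num_components_connected_le:
  assumes "connected S"
  shows "num_components S \<le> 1"
proof -
  have "components S \<subseteq> {S}"
    using assms by (cases "S = {}") (auto simp: components_eq_sing_iff[THEN iffD2])
  then have "finite (components S)" "card (components S) \<le> 1"
    using finite_subset card_mono[of "{S}" "components S"] by auto
  then show ?thesis by (simp add: num_components_def one_enat_def)
qed

lemma num_components_solution_set3_le:
  assumes "0 < b"
  shows "num_components (solution_set3 a1 a2 a3 r1 r2 r3 b) \<le> 5"
  using solution_set3_connected_or_card_le[OF assms, of a1 a2 a3 r1 r2 r3]
proof
  assume "connected (solution_set3 a1 a2 a3 r1 r2 r3 b)"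
  then show ?thesis
    using num_components_connected_le order_trans[of _ 1 "5::enat"] by (auto simp: one_enat_def numeral_eq_enat)
next
  assume "finite (solution_set3 a1 a2 a3 r1 r2 r3 b) \<and> card (solution_set3 a1 a2 a3 r1 r2 r3 b) \<le> 5"
  then show ?thesis by (simp add: num_components_finite numeral_eq_enat)
qed

section \<open>Five solutions\<close>

text \<open>With \<open>a\<^sub>2 + g\<^sub>1\<^bsup>1/3\<^esup> = t\<^sup>2\<close> the equation becomes
  \<open>(97/100 + t)\<^sup>7 = (37/25)\<^sup>7 ((t\<^sup>2 + 51/50)\<^sup>3 - 1)\<close>. The exponents come from
  a numerical search; the difference of the two sides has the signs \<open>- + - + - +\<close> at
  \<open>t = 1/100, 1/10, 1/2, 3/2, 4, 20\<close>.\<close>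

definition ex_point :: "real \<Rightarrow> real" where
  "ex_point t = ((t\<^sup>2 + 51/50) ^ 3 - 1) powr (1/7)"

abbreviation "ex_dom \<equiv> I3 1 (-51/50) (97/100) 7 (1/3) (1/2)"

definition ex_diff :: "real \<Rightarrow> real" where
  "ex_diff x = spow (97/100) (1/2) (spow (-51/50) (1/3) (spow 1 7 x)) - 37/25 * x"

text \<open>\<open>ex_point\<close> inverts the substitution: g1 is the cube of
  \<open>t\<^sup>2 + 51/50\<close> and x is the seventh root of g1 - 1, which is positive because
  51/50 exceeds 1.\<close>

lemma ex_point_facts:
  assumes t: "0 < t"
  shows "0 < ex_point t" "ex_point t ^ 7 = (t\<^sup>2 + 51/50) ^ 3 - 1" "ex_point t \<in> ex_dom"
    "ex_diff (ex_point t) = 97/100 + t - 37/25 * ex_point t"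
proof -
  have s: "1 < (t\<^sup>2 + 51/50) ^ 3"
    by (rule one_less_power) (use zero_le_power2[of t] in \<open>linarith, simp\<close>)
  then show p: "0 < ex_point t" by (simp add: ex_point_def)
  have "ex_point t powr 7 = (t\<^sup>2 + 51/50) ^ 3 - 1"
    using s by (simp add: ex_point_def powr_powr)
  then show pow7: "ex_point t ^ 7 = (t\<^sup>2 + 51/50) ^ 3 - 1"
    using p by (simp add: powr_numeral)
  then have g1: "spow 1 7 (ex_point t) = (t\<^sup>2 + 51/50) ^ 3"
    using p by (simp add: spow_def powr_numeral)
  have "((t\<^sup>2 + 51/50) ^ 3) powr (1/3) = t\<^sup>2 + 51/50"
  proof -
    have "0 < t\<^sup>2 + 51/50" using zero_le_power2[of t] by linarith
    then have "((t\<^sup>2 + 51/50) ^ 3) powr (1/3) = ((t\<^sup>2 + 51/50) powr 3) powr (1/3)"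
      by (simp add: powr_numeral)
    also have "\<dots> = t\<^sup>2 + 51/50" using \<open>0 < t\<^sup>2 + 51/50\<close> by (simp only: powr_powr) simp
    finally show ?thesis .
  qed
  then have g2: "spow (-51/50) (1/3) (spow 1 7 (ex_point t)) = t\<^sup>2"
    unfolding g1 by (simp add: spow_def)
  have g3: "spow (97/100) (1/2) (spow (-51/50) (1/3) (spow 1 7 (ex_point t))) = 97/100 + t"
    unfolding g2 using t by (simp add: spow_def powr_half_sqrt)
  show "ex_point t \<in> ex_dom"
    unfolding mem_I3 g3 unfolding g2 unfolding g1 using p t zero_le_power2[of t]
    by (intro conjI zero_less_power; linarith?)
  show "ex_diff (ex_point t) = 97/100 + t - 37/25 * ex_point t" unfolding ex_diff_def g3 ..
qed

text \<open>Comparing seventh powers of positive numbers removes the root, so at rational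
  \<open>t\<close> the sign reduces to rational arithmetic.\<close>

lemma ex_diff_neg:
  assumes "0 < t" "(97/100 + t) ^ 7 < (37/25) ^ 7 * ((t\<^sup>2 + 51/50) ^ 3 - 1)"
  shows "ex_diff (ex_point t) < 0"
proof -
  have "(97/100 + t) ^ 7 < (37/25 * ex_point t) ^ 7"
    using assms by (simp only: power_mult_distrib ex_point_facts)
  then have "97/100 + t < 37/25 * ex_point t"
    by (rule power_less_imp_less_base) (use ex_point_facts(1)[OF assms(1)] in auto)
  then show ?thesis by (simp add: ex_point_facts assms)
qed

lemma ex_diff_pos:
  assumes "0 < t" "(37/25) ^ 7 * ((t\<^sup>2 + 51/50) ^ 3 - 1) < (97/100 + t) ^ 7"
  shows "0 < ex_diff (ex_point t)"
proof -
  have "(37/25 * ex_point t) ^ 7 < (97/100 + t) ^ 7"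
    using assms by (simp only: power_mult_distrib ex_point_facts)
  then have "37/25 * ex_point t < 97/100 + t"
    by (rule power_less_imp_less_base) (use assms in auto)
  then show ?thesis by (simp add: ex_point_facts assms)
qed

lemma ex_point_less:
  assumes "0 < s" "s < t"
  shows "ex_point s < ex_point t"
proof -
  have "(s\<^sup>2 + 51/50) ^ 3 < (t\<^sup>2 + 51/50) ^ 3"
    using assms by (intro power_strict_mono add_strict_right_mono) auto
  then have "ex_point s ^ 7 < ex_point t ^ 7"
    using assms by (simp add: ex_point_facts)
  then show ?thesis
    by (rule power_less_imp_less_base) (use ex_point_facts(1)[of t] assms in auto)
qed

text \<open>The intermediate value theorem on a segment inside the domain. The bounds on
  \<open>x\<close> are strict since \<open>ex_diff\<close> is nonzero at both ends; this keeps zeros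
  from adjacent segments distinct.\<close>

lemma ex_diff_zero_between:
  assumes "0 < s" "s < t" "ex_diff (ex_point s) * ex_diff (ex_point t) < 0"
  obtains x where "ex_point s < x" "x < ex_point t" "x \<in> ex_dom" "ex_diff x = 0"
proof -
  have lt: "ex_point s < ex_point t" using ex_point_less assms by blast
  have sub: "x \<in> ex_dom" if "x \<in> {ex_point s..ex_point t}" for x
    using is_interval_I3[unfolded is_interval_1, rule_format, OF ex_point_facts(3) ex_point_facts(3)]
      assms that by (meson atLeastAtMost_iff less_trans)
  have cont: "continuous_on {ex_point s..ex_point t} ex_diff"
    unfolding ex_diff_def using sub displacement_has_derivative
    by (intro continuous_at_imp_continuous_on ballI) (blast intro: DERIV_isCont)
  have "\<exists>x\<ge>ex_point s. x \<le> ex_point t \<and> ex_diff x = 0"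
  proof (cases "ex_diff (ex_point s) < 0")
    case True
    then show ?thesis
      using assms(3) lt by (intro IVT'[OF _ _ _ cont]) (auto simp: mult_less_0_iff)
  next
    case False
    then show ?thesis
      using assms(3) lt by (intro IVT2'[OF _ _ _ cont]) (auto simp: mult_less_0_iff)
  qed
  then obtain x where x: "ex_point s \<le> x" "x \<le> ex_point t" "ex_diff x = 0" by blast
  moreover have "x \<noteq> ex_point s" "x \<noteq> ex_point t" using assms(3) x(3) by auto
  ultimately show ?thesis using that sub by force
qed

lemma num_components_example:
  "num_components (solution_set3 1 (-51/50) (97/100) 7 (1/3) (1/2) (37/25)) \<ge> 5"
proof -
  let ?S = "solution_set3 1 (-51/50) (97/100) 7 (1/3) (1/2) (37/25)"
  have n0: "ex_diff (ex_point (1/100)) < 0" and n2: "ex_diff (ex_point (1/2)) < 0"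
    and n4: "ex_diff (ex_point 4) < 0"
    by (rule ex_diff_neg; simp add: field_simps eval_nat_numeral)+
  have p1: "0 < ex_diff (ex_point (1/10))" and p3: "0 < ex_diff (ex_point (3/2))"
    and p5: "0 < ex_diff (ex_point 20)"
    by (rule ex_diff_pos; simp add: field_simps eval_nat_numeral)+
  obtain x1 where x1: "ex_point (1/100) < x1" "x1 < ex_point (1/10)" "x1 \<in> ex_dom" "ex_diff x1 = 0"
    by (rule ex_diff_zero_between[of "1/100" "1/10"]) (use n0 p1 mult_neg_pos in auto)
  obtain x2 where x2: "ex_point (1/10) < x2" "x2 < ex_point (1/2)" "x2 \<in> ex_dom" "ex_diff x2 = 0"
    by (rule ex_diff_zero_between[of "1/10" "1/2"]) (use n2 p1 mult_pos_neg in auto)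
  obtain x3 where x3: "ex_point (1/2) < x3" "x3 < ex_point (3/2)" "x3 \<in> ex_dom" "ex_diff x3 = 0"
    by (rule ex_diff_zero_between[of "1/2" "3/2"]) (use n2 p3 mult_neg_pos in auto)
  obtain x4 where x4: "ex_point (3/2) < x4" "x4 < ex_point 4" "x4 \<in> ex_dom" "ex_diff x4 = 0"
    by (rule ex_diff_zero_between[of "3/2" 4]) (use n4 p3 mult_pos_neg in auto)
  obtain x5 where x5: "ex_point 4 < x5" "x5 < ex_point 20" "x5 \<in> ex_dom" "ex_diff x5 = 0"
    by (rule ex_diff_zero_between[of 4 20]) (use n4 p5 mult_neg_pos in auto)
  have sub: "{x1, x2, x3, x4, x5} \<subseteq> ?S"
    using x1 x2 x3 x4 x5 by (simp add: solution_set3_eq ex_diff_def)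
  \<comment> \<open>Five zeros need not lie in five components. But \<open>ex_point (1/10)\<close>
    is a non-solution between \<open>x1\<close> and \<open>x2\<close>, so \<open>?S\<close> is not
    connected, and the dichotomy makes it finite.\<close>
  have "ex_point (1/10) \<notin> ?S" using p1 by (simp add: solution_set3_eq ex_diff_def)
  moreover have "ex_point (1/10) \<in> ?S" if "connected ?S"
    using that sub x1(2) x2(1) unfolding is_interval_connected_1[symmetric] is_interval_1
    by (meson insert_subset less_imp_le)
  ultimately have fin: "finite ?S"
    using solution_set3_connected_or_card_le[of "37/25" 1 "-51/50" "97/100" 7 "1/3" "1/2"] by auto
  have "x1 < x2" "x2 < x3" "x3 < x4" "x4 < x5" using x1 x2 x3 x4 x5 by linarith+
  then have "card {x1, x2, x3, x4, x5} = 5" by simp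
  then have "5 \<le> card ?S" using card_mono[OF fin sub] by simp
  then show ?thesis using fin by (simp add: num_components_finite numeral_eq_enat)
qed

theorem mainTheorem3:
  shows "fp3 = 5"
proof (rule antisym)
  show "fp3 \<le> 5"
    unfolding fp3_def by (rule Sup_least) (auto intro: num_components_solution_set3_le)
  have "num_components (solution_set3 1 (-51/50) (97/100) 7 (1/3) (1/2) (37/25)) \<le> fp3"
    unfolding fp3_def
    by (rule Sup_upper, rule CollectI,
        rule exI[of _ 1], rule exI[of _ "-51/50"], rule exI[of _ "97/100"], rule exI[of _ 7],
        rule exI[of _ "1/3"], rule exI[of _ "1/2"], rule exI[of _ "37/25"]) simp
  then show "5 \<le> fp3" using num_components_example order_trans by blast
qed

end
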